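(* Let $G$ be a finite simple graph with minimum degree $\delta\geq 3$ which is $(\delta-2)$-fault Hamiltonian, and let $\alpha(G)$ denote its independence number and $|G|$ its number of vertices. (i) If $\alpha(G)\leq \lceil \frac{|G|+1}{2}\rceil -\delta$, then $fsmp(G)=fmp(G)=\delta$. (ii) If $G\in \mathcal{G}_1(\delta)$ and $\alpha(G)\leq \lceil \frac{|G|+1}{2}\rceil -\delta+1$, then $fsmp(G)=fmp(G)=\delta$. (iii) If $G\in \mathcal{G}_2(4)$ and $\alpha(G)\leq \frac{|G|+1}{2}-2$, then $fsmp(G)=fmp(G)=4$.
   Context: All graphs are finite, simple and undirected; $|G|$ denotes the number of vertices of $G$. For a set $F$ of vertices and/or edges of $G$, $G-F$ is the graph obtained from $G$ by deleting the vertices in $F$ (with their incident edges) and the edges in $F$. A graph $G$ is $f$-fault Hamiltonian if $G-F$ has a Hamiltonian cycle for every set $F$ of vertices and/or edges of $G$ with $|F|\leq f$. A fractional perfect matching of $G$ is a function $g:E(G)\to[0,1]$ with $\sum_{e\ni v} g(e)=1$ for every vertex $v$. $fmp(G)$ is the minimum size of a set $F\subseteq E(G)$ such that $G-F$ has no fractional perfect matching; $fsmp(G)$ is the minimum size of a set $F\subseteq V(G)\cup E(G)$ such that $G-F$ has no fractional perfect matching. A graph is odd (even) if it has an odd (even) number of vertices. A graph is $\mathcal{H}$-free if it contains no induced subgraph isomorphic to a member of $\mathcal{H}$; $K_4-e$ is $K_4$ with one edge removed. $\mathcal{G}_1(k)$ is the class of $k$-regular graphs $G$ such that either $G$ is odd,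 or $G$ is even, $\{K_4-e\}$-free, and every edge of $G$ lies in at least one $3$-cycle and at least one $4$-cycle. $\mathcal{G}_2(4)$ is the class of $4$-regular, $\{K_4,K_4-e,K_{2,3}\}$-free odd graphs in which every edge lies in at least one $3$-cycle and at least two $4$-cycles.
   Formalization: In (ii) the claim fsmp(G)=δ is asserted only for G not isomorphic to K_4 (K_4 meets all hypotheses, but deleting a vertex and an edge leaves a 3-vertex path, so fsmp(K_4)≤2); fmp(G)=δ is kept for all G. *)

theory Defs
  imports Complex_Main
begin

record 'a graph =
  verts :: "'a set"
  edges :: "'a set set"

definition simple_graph :: "'a graph \<Rightarrow> bool" where
  "simple_graph G \<longleftrightarrow> finite (verts G) \<and> (\<forall>e\<in>edges G. e \<subseteq> verts G \<and> card e = 2)"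

definition degree :: "'a graph \<Rightarrow> 'a \<Rightarrow> nat" where
  "degree G v = card {e \<in> edges G. v \<in> e}"

(* Meaningful for a nonempty vertex set only; every Hamiltonian graph has one. *)
definition min_degree :: "'a graph \<Rightarrow> nat" where
  "min_degree G = Min (degree G ` verts G)"

definition regular :: "nat \<Rightarrow> 'a graph \<Rightarrow> bool" where
  "regular k G \<longleftrightarrow> (\<forall>v\<in>verts G. degree G v = k)"

definition independent_set :: "'a graph \<Rightarrow> 'a set \<Rightarrow> bool" where
  "independent_set G S \<longleftrightarrow> S \<subseteq> verts G \<and> (\<forall>e\<in>edges G. \<not> e \<subseteq> S)"

definition independence_number :: "'a graph \<Rightarrow> nat" where
  "independence_number G = Max {card S |S. independent_set G S}"

(* A set of vertices and/or edges of G is a subset F of the disjoint sum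
   verts G <+> edges G: Inl tags vertices, Inr tags edges. *)
definition delete :: "'a graph \<Rightarrow> ('a + 'a set) set \<Rightarrow> 'a graph" where
  "delete G F = \<lparr>verts = {v \<in> verts G. Inl v \<notin> F},
                 edges = {e \<in> edges G. Inr e \<notin> F \<and> (\<forall>v\<in>e. Inl v \<notin> F)}\<rparr>"

definition cycle_edges :: "'a list \<Rightarrow> 'a set set" where
  "cycle_edges vs = {{vs ! i, vs ! (Suc i mod length vs)} |i. i < length vs}"

definition is_cycle :: "'a graph \<Rightarrow> 'a list \<Rightarrow> bool" where
  "is_cycle G vs \<longleftrightarrow> 3 \<le> length vs \<and> distinct vs \<and> set vs \<subseteq> verts G \<and> cycle_edges vs \<subseteq> edges G"

(* A cycle is identified with its edge set, so that rotations and reversals of a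
   vertex list are not counted as different cycles. Cycles need not be induced. *)
definition cycles_through :: "'a graph \<Rightarrow> nat \<Rightarrow> 'a set \<Rightarrow> 'a set set set" where
  "cycles_through G k e = {cycle_edges vs |vs. is_cycle G vs \<and> length vs = k \<and> e \<in> cycle_edges vs}"

definition hamiltonian :: "'a graph \<Rightarrow> bool" where
  "hamiltonian G \<longleftrightarrow> (\<exists>vs. is_cycle G vs \<and> set vs = verts G)"

definition fault_hamiltonian :: "nat \<Rightarrow> 'a graph \<Rightarrow> bool" where
  "fault_hamiltonian f G \<longleftrightarrow>
     (\<forall>F. F \<subseteq> verts G <+> edges G \<and> card F \<le> f \<longrightarrow> hamiltonian (delete G F))"

definition fractional_perfect_matching :: "'a graph \<Rightarrow> ('a set \<Rightarrow> real) \<Rightarrow> bool" where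
  "fractional_perfect_matching G g \<longleftrightarrow>
     (\<forall>e\<in>edges G. 0 \<le> g e \<and> g e \<le> 1) \<and>
     (\<forall>v\<in>verts G. (\<Sum>e\<in>{e \<in> edges G. v \<in> e}. g e) = 1)"

definition has_fpm :: "'a graph \<Rightarrow> bool" where
  "has_fpm G \<longleftrightarrow> (\<exists>g. fractional_perfect_matching G g)"

(* In both definitions the minimum is attained as soon as G has a vertex:
   deleting all edges at that vertex leaves no fractional perfect matching. *)
definition fmp :: "'a graph \<Rightarrow> nat" where
  "fmp G = (LEAST n. \<exists>F. F \<subseteq> edges G \<and> card F = n \<and> \<not> has_fpm (delete G (Inr ` F)))"

definition fsmp :: "'a graph \<Rightarrow> nat" where
  "fsmp G = (LEAST n. \<exists>F. F \<subseteq> verts G <+> edges G \<and> card F = n \<and> \<not> has_fpm (delete G F))"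

definition graph_iso :: "'a graph \<Rightarrow> 'b graph \<Rightarrow> bool" where
  "graph_iso G H \<longleftrightarrow> (\<exists>\<phi>. bij_betw \<phi> (verts G) (verts H) \<and>
     (\<forall>u\<in>verts G. \<forall>v\<in>verts G. {u, v} \<in> edges G \<longleftrightarrow> {\<phi> u, \<phi> v} \<in> edges H))"

definition induced_subgraph :: "'a graph \<Rightarrow> 'a set \<Rightarrow> 'a graph" where
  "induced_subgraph G S = \<lparr>verts = S, edges = {e \<in> edges G. e \<subseteq> S}\<rparr>"

definition free_of :: "'b graph set \<Rightarrow> 'a graph \<Rightarrow> bool" where
  "free_of \<H> G \<longleftrightarrow> (\<forall>H\<in>\<H>. \<not> (\<exists>S\<subseteq>verts G. graph_iso (induced_subgraph G S) H))"

definition K4 :: "nat graph" where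
  "K4 = \<lparr>verts = {0, 1, 2, 3}, edges = {{0, 1}, {0, 2}, {0, 3}, {1, 2}, {1, 3}, {2, 3}}\<rparr>"

definition K4_minus_edge :: "nat graph" where
  "K4_minus_edge = \<lparr>verts = {0, 1, 2, 3}, edges = {{0, 2}, {0, 3}, {1, 2}, {1, 3}, {2, 3}}\<rparr>"

definition K23 :: "nat graph" where
  "K23 = \<lparr>verts = {0, 1, 2, 3, 4}, edges = {{0, 2}, {0, 3}, {0, 4}, {1, 2}, {1, 3}, {1, 4}}\<rparr>"

definition class_G1 :: "nat \<Rightarrow> 'a graph set" where
  "class_G1 k = {G. simple_graph G \<and> regular k G \<and>
     (odd (card (verts G)) \<or>
      even (card (verts G)) \<and> free_of {K4_minus_edge} G \<and>
      (\<forall>e\<in>edges G. card (cycles_through G 3 e) \<ge> 1 \<and> card (cycles_through G 4 e) \<ge> 1))}"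

definition class_G2_4 :: "'a graph set" where
  "class_G2_4 = {G. simple_graph G \<and> regular 4 G \<and> free_of {K4, K4_minus_edge, K23} G \<and>
     odd (card (verts G)) \<and>
     (\<forall>e\<in>edges G. card (cycles_through G 3 e) \<ge> 1 \<and> card (cycles_through G 4 e) \<ge> 2)}"


lemma cycle_edges_3: "cycle_edges [a, b, c] = {{a, b}, {b, c}, {c, a}}"
proof -
  have *: "{i. i < length [a, b, c]} = {0, 1, 2}" by auto
  show ?thesis unfolding cycle_edges_def setcompr_eq_image * by simp
qed

lemma cycle_edges_4: "cycle_edges [a, b, c, d] = {{a, b}, {b, c}, {c, d}, {d, a}}"
proof -
  have *: "{i. i < length [a, b, c, d]} = {0, 1, 2, 3}" by auto
  show ?thesis unfolding cycle_edges_def setcompr_eq_image * by simp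
qed

lemma finite_cycles_through:
  assumes "simple_graph G"
  shows "finite (cycles_through G k e)"
proof (rule finite_subset)
  show "cycles_through G k e \<subseteq> Pow (Pow (verts G))"
    using assms unfolding cycles_through_def is_cycle_def simple_graph_def by blast
  show "finite (Pow (Pow (verts G)))"
    using assms by (simp add: simple_graph_def)
qed

lemma simple_graph_K4: "simple_graph K4"
  by (auto simp: simple_graph_def K4_def)

lemma degree_K4: "v \<in> verts K4 \<Longrightarrow> degree K4 v = 3"
proof -
  assume "v \<in> verts K4"
  then consider "v = 0" | "v = 1" | "v = 2" | "v = 3" by (auto simp: K4_def)
  then show ?thesis
  proof cases
    case 1
    then have "{e \<in> edges K4. v \<in> e} = {{0, 1}, {0, 2}, {0, 3}}" by (auto simp: K4_def)
    then show ?thesis by (simp add: degree_def doubleton_eq_iff)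
  next
    case 2
    then have "{e \<in> edges K4. v \<in> e} = {{0, 1}, {1, 2}, {1, 3}}" by (auto simp: K4_def)
    then show ?thesis by (simp add: degree_def doubleton_eq_iff)
  next
    case 3
    then have "{e \<in> edges K4. v \<in> e} = {{0, 2}, {1, 2}, {2, 3}}" by (auto simp: K4_def)
    then show ?thesis by (simp add: degree_def doubleton_eq_iff)
  next
    case 4
    then have "{e \<in> edges K4. v \<in> e} = {{0, 3}, {1, 3}, {2, 3}}" by (auto simp: K4_def)
    then show ?thesis by (simp add: degree_def doubleton_eq_iff)
  qed
qed

lemma min_degree_K4: "min_degree K4 = 3"
proof -
  have "degree K4 ` verts K4 = (\<lambda>_. 3) ` verts K4"
    by (rule image_cong) (simp_all add: degree_K4)
  then show ?thesis by (simp add: min_degree_def K4_def)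
qed

lemma verts_K4: "verts K4 = {0, 1, 2, 3}"
  by (simp add: K4_def)

lemma edges_K4I: "\<lbrakk>a \<in> verts K4; b \<in> verts K4; a \<noteq> b\<rbrakk> \<Longrightarrow> {a, b} \<in> edges K4"
  unfolding K4_def graph.simps insert_iff empty_iff
  by (elim disjE FalseE) (simp_all add: insert_commute)

lemma edges_K4E:
  assumes "e \<in> edges K4"
  obtains a b where "a \<in> verts K4" "b \<in> verts K4" "a \<noteq> b" "e = {a, b}"
proof -
  have "card e = 2" "e \<subseteq> verts K4" using assms simple_graph_K4 by (auto simp: simple_graph_def)
  then show ?thesis using that by (auto simp: card_2_iff)
qed

lemma extend_K4:
  assumes "a \<in> verts K4" "b \<in> verts K4" "a \<noteq> b"
  obtains c d where "distinct [a, b, c, d]" "verts K4 = {a, b, c, d}"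
proof -
  have "card (verts K4 - {a, b}) = 2"
    using assms by (subst card_Diff_subset) (auto simp: verts_K4)
  then obtain c d where cd: "verts K4 - {a, b} = {c, d}" "c \<noteq> d"
    by (auto simp: card_2_iff)
  have "distinct [a, b, c, d]" using cd assms(3) by auto
  moreover have "verts K4 = {a, b, c, d}" using cd(1) assms(1,2) by blast
  ultimately show ?thesis by (rule that)
qed

lemma cycles_K4:
  assumes "e \<in> edges K4"
  shows "card (cycles_through K4 3 e) \<ge> 1" and "card (cycles_through K4 4 e) \<ge> 1"
proof -
  obtain a b where ab: "a \<in> verts K4" "b \<in> verts K4" "a \<noteq> b" "e = {a, b}"
    using assms by (rule edges_K4E)
  obtain c d where cd: "distinct [a, b, c, d]" "verts K4 = {a, b, c, d}"
    using ab(1-3) by (rule extend_K4)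
  have "is_cycle K4 [a, b, c]"
    unfolding is_cycle_def cycle_edges_3 using cd edges_K4I by auto
  moreover have "e \<in> cycle_edges [a, b, c]" by (simp add: cycle_edges_3 ab(4))
  ultimately have "cycles_through K4 3 e \<noteq> {}"
    unfolding cycles_through_def by fastforce
  then show "card (cycles_through K4 3 e) \<ge> 1"
    using finite_cycles_through[OF simple_graph_K4] by (simp add: Suc_leI card_gt_0_iff)
  have "is_cycle K4 [a, b, c, d]"
    unfolding is_cycle_def cycle_edges_4 using cd edges_K4I by auto
  moreover have "e \<in> cycle_edges [a, b, c, d]" by (simp add: cycle_edges_4 ab(4))
  ultimately have "cycles_through K4 4 e \<noteq> {}"
    unfolding cycles_through_def by fastforce
  then show "card (cycles_through K4 4 e) \<ge> 1"
    using finite_cycles_through[OF simple_graph_K4] by (simp add: Suc_leI card_gt_0_iff)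
qed

lemma free_K4: "free_of {K4_minus_edge} K4"
proof -
  have False if S: "S \<subseteq> verts K4" and iso: "graph_iso (induced_subgraph K4 S) K4_minus_edge" for S
  proof -
    from iso obtain \<phi> where bij: "bij_betw \<phi> S {0, 1, 2, 3}"
      and adj: "\<And>u v. u \<in> S \<Longrightarrow> v \<in> S \<Longrightarrow>
        {u, v} \<in> edges (induced_subgraph K4 S) \<longleftrightarrow> {\<phi> u, \<phi> v} \<in> edges K4_minus_edge"
      unfolding graph_iso_def by (auto simp: induced_subgraph_def K4_minus_edge_def)
    obtain u v where uv: "u \<in> S" "v \<in> S" "\<phi> u = 0" "\<phi> v = 1"
      using bij unfolding bij_betw_def by (metis imageE insertCI)
    have ne: "u \<noteq> v" using uv by auto
    have in4: "u \<in> verts K4" "v \<in> verts K4" using uv S by auto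
    have "{u, v} \<in> edges K4" using in4 ne by (rule edges_K4I)
    then have "{u, v} \<in> edges (induced_subgraph K4 S)" using uv by (simp add: induced_subgraph_def)
    then have "{0, 1} \<in> edges K4_minus_edge" using adj uv by metis
    then show False by (auto simp: K4_minus_edge_def doubleton_eq_iff)
  qed
  then show ?thesis by (auto simp: free_of_def)
qed

lemma K4_in_class_G1: "K4 \<in> class_G1 3"
proof -
  have "card (verts K4) = 4" by (simp add: K4_def)
  then show ?thesis
    using cycles_K4 free_K4 simple_graph_K4 degree_K4 by (auto simp: class_G1_def regular_def)
qed

lemma independence_number_K4: "independence_number K4 = 1"
proof -
  have "card S \<le> 1" if "independent_set K4 S" for S
  proof (rule ccontr)
    assume "\<not> card S \<le> 1"
    then obtain a b where "a \<in> S" "b \<in> S" "a \<noteq> b"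
      by (metis One_nat_def card_le_Suc0_iff_eq card.infinite zero_le)
    moreover from this have "{a, b} \<in> edges K4"
      using that by (intro edges_K4I) (auto simp: independent_set_def K4_def)
    ultimately show False using that by (auto simp: independent_set_def)
  qed
  moreover have "independent_set K4 {0}" by (auto simp: independent_set_def K4_def)
  ultimately show ?thesis
    unfolding independence_number_def
    by (intro Max_eqI) (auto intro: finite_subset[of _ "{..1}"] exI[of _ "{0}"])
qed

lemma fault_hamiltonian_K4: "fault_hamiltonian 1 K4"
  unfolding fault_hamiltonian_def
proof (intro allI impI, elim conjE)
  fix F assume F: "F \<subseteq> verts K4 <+> edges K4" "card F \<le> 1"
  have "finite F"
    using F(1) by (rule finite_subset) (simp add: K4_def)
  then consider "F = {}" | v where "F = {Inl v}" | e where "F = {Inr e}"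
    using F(2) by (metis One_nat_def card_0_eq card_1_singletonE le_Suc_eq le_zero_eq sumE)
  then show "hamiltonian (delete K4 F)"
  proof cases
    case 1
    have "0 \<in> verts K4" "1 \<in> verts K4" "(0::nat) \<noteq> 1" by (simp_all add: verts_K4)
    then obtain c d where cd: "distinct [0, 1, c, d]" "verts K4 = {0, 1, c, d}"
      by (rule extend_K4)
    have "is_cycle K4 [0, 1, c, d]"
      unfolding is_cycle_def cycle_edges_4 using cd edges_K4I by auto
    moreover have "delete K4 F = K4" by (simp add: delete_def 1)
    ultimately show ?thesis
      unfolding hamiltonian_def using cd(2) by (intro exI[of _ "[0, 1, c, d]"]) simp
  next
    case (2 v)
    then have v: "v \<in> verts K4" using F by auto
    obtain b where "b \<in> verts K4" "v \<noteq> b"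
    proof (cases "v = 0")
      case True
      with that[of 1] show ?thesis by (simp add: verts_K4)
    next
      case False
      with that[of 0] show ?thesis by (simp add: verts_K4)
    qed
    with v obtain c d where cd: "distinct [v, b, c, d]" "verts K4 = {v, b, c, d}"
      by (rule extend_K4)
    have V: "verts (delete K4 F) = {b, c, d}" using cd by (auto simp: delete_def 2)
    have E: "edges (delete K4 F) = {e \<in> edges K4. v \<notin> e}" by (auto simp: delete_def 2)
    have "is_cycle (delete K4 F) [b, c, d]"
      unfolding is_cycle_def cycle_edges_3 V E using cd edges_K4I by auto
    then show ?thesis
      unfolding hamiltonian_def V by (intro exI[of _ "[b, c, d]"]) simp
  next
    case (3 e)
    then have e: "e \<in> edges K4" using F by auto
    then obtain a b where ab: "a \<in> verts K4" "b \<in> verts K4" "a \<noteq> b" "e = {a, b}"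
      by (rule edges_K4E)
    obtain c d where cd: "distinct [a, b, c, d]" "verts K4 = {a, b, c, d}"
      using ab(1-3) by (rule extend_K4)
    have V: "verts (delete K4 F) = {a, b, c, d}" using cd by (auto simp: delete_def 3)
    have E: "edges (delete K4 F) = edges K4 - {{a, b}}" by (auto simp: delete_def 3 ab(4))
    have "is_cycle (delete K4 F) [a, c, b, d]"
      unfolding is_cycle_def cycle_edges_4 V E using cd edges_K4I by (auto simp: doubleton_eq_iff)
    then show ?thesis
      unfolding hamiltonian_def V by (intro exI[of _ "[a, c, b, d]"]) auto
  qed
qed

lemma fsmp_K4: "fsmp K4 \<le> 2"
proof -
  let ?F = "{Inl 0, Inr {1, 2}} :: (nat + nat set) set"
  let ?H = "delete K4 ?F"
  have V: "verts ?H = {1, 2, 3}" by (auto simp: delete_def K4_def)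
  have ED: "edges ?H = {{1, 3}, {2, 3}}" by (auto simp: delete_def K4_def doubleton_eq_iff)
  have "\<not> has_fpm ?H"
  proof
    assume "has_fpm ?H"
    then obtain g :: "nat set \<Rightarrow> real" where g: "\<forall>v\<in>verts ?H. (\<Sum>e\<in>{e \<in> edges ?H. v \<in> e}. g e) = 1"
      unfolding has_fpm_def fractional_perfect_matching_def by blast
    have in_H: "1 \<in> verts ?H" "2 \<in> verts ?H" "3 \<in> verts ?H" unfolding V by simp_all
    have "{e \<in> edges ?H. 1 \<in> e} = {{1, 3}}" unfolding ED by auto
    then have 1: "g {1, 3} = 1" using bspec[OF g in_H(1)] by simp
    have "{e \<in> edges ?H. 2 \<in> e} = {{2, 3}}" unfolding ED by auto
    then have 2: "g {2, 3} = 1" using bspec[OF g in_H(2)] by simp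
    have "{e \<in> edges ?H. 3 \<in> e} = {{1, 3}, {2, 3}}" unfolding ED by auto
    then have "g {1, 3} + g {2, 3} = 1" using bspec[OF g in_H(3)] by (simp add: doubleton_eq_iff)
    with 1 2 show False by linarith
  qed
  moreover have "?F \<subseteq> verts K4 <+> edges K4" "card ?F = 2" by (auto simp: K4_def)
  ultimately show ?thesis unfolding fsmp_def by (intro Least_le) blast
qed

(* K4 meets every hypothesis of the class_G1 case but has fsmp K4 < 3: deleting one
   vertex and one edge leaves a path on three vertices. The claim about fsmp in that
   case is therefore only asserted for graphs not isomorphic to K4. *)
lemma K4_exceptional:
  "simple_graph K4" "min_degree K4 = 3" "fault_hamiltonian (3 - 2) K4" "K4 \<in> class_G1 3"
  "int (independence_number K4) \<le> \<lceil>(real (card (verts K4)) + 1) / 2\<rceil> - int 3 + 1" "fsmp K4 \<noteq> 3"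
proof -
  have "card (verts K4) = 4" by (simp add: K4_def)
  moreover have "\<lceil>5 / 2 :: real\<rceil> = 3" by (simp add: ceiling_eq_iff)
  ultimately show "int (independence_number K4) \<le> \<lceil>(real (card (verts K4)) + 1) / 2\<rceil> - int 3 + 1"
    by (simp add: independence_number_K4)
qed (use simple_graph_K4 min_degree_K4 fault_hamiltonian_K4 K4_in_class_G1 fsmp_K4 in auto)

end

theory Submission
  imports Defs
begin

text \<open>
  Deleting fewer than \<open>\<delta>\<close> vertices and edges leaves a Hamiltonian cycle up to one last deletion, so
  \<open>G - F\<close> still has a Hamiltonian path. If its order is even, every other edge of the path is a
  perfect matching. If it is odd, either a chord between two vertices at even distance on the path
  closes an odd cycle and leaves even paths, or every second vertex of the path forms an independent
  set \<open>S\<close> of \<open>G - F\<close>. In \<open>G\<close> the few deleted edges inside \<open>S\<close> can be repaired by dropping one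
  endpoint each, and (i) follows. For (ii) and (iii), regularity ties the number of edges inside \<open>S\<close>
  to the number inside its complement. The complement of \<open>S\<close> then refutes odd order in (ii); in the
  other cases a weighting of triangles shows that at most two thirds of all edges leave \<open>S\<close>, which
  makes \<open>G\<close> too small.
\<close>

section \<open>Fractional perfect matchings from permutations\<close>

lemma simple_graph_finite_edges: "simple_graph G \<Longrightarrow> finite (edges G)"
  by (rule finite_subset[of _ "Pow (verts G)"]) (auto simp: simple_graph_def)

lemma simple_graph_edgeD:
  assumes "simple_graph G" "{a, b} \<in> edges G"
  shows "a \<in> verts G" "b \<in> verts G" "a \<noteq> b"
  using assms by (auto simp: simple_graph_def)

lemma simple_graph_delete: "simple_graph G \<Longrightarrow> simple_graph (delete G F)"
  by (force simp: simple_graph_def delete_def)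

text \<open>Orienting every edge \<open>{v, \<sigma> v}\<close> from \<open>v\<close> makes each
  vertex once a tail and once a head. Weight 1/2 per orientation therefore sums to 1 at every
  vertex. This covers single edges and cycles of either parity at once.\<close>

lemma has_fpm_if_permutation:
  assumes G: "simple_graph G"
    and bij: "bij_betw \<sigma> (verts G) (verts G)"
    and adj: "\<And>v. v \<in> verts G \<Longrightarrow> {v, \<sigma> v} \<in> edges G"
  shows "has_fpm G"
proof -
  have fin: "finite (verts G)" "finite (edges G)"
    using G simple_graph_finite_edges by (auto simp: simple_graph_def)
  \<comment> \<open>Summing over vertices rather than edges lets an edge whose ends are swapped by
    \<open>\<sigma>\<close> collect 1/2 twice.\<close>
  define g :: "'a set \<Rightarrow> real" where "g e = (\<Sum>v\<in>verts G. if e = {v, \<sigma> v} then 1/2 else 0)" for e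
  have nonneg: "0 \<le> g e" for e unfolding g_def by (rule sum_nonneg) auto
  have total: "(\<Sum>e\<in>{e \<in> edges G. u \<in> e}. g e) = 1" if u: "u \<in> verts G" for u
  proof -
    have "(\<Sum>e\<in>{e \<in> edges G. u \<in> e}. g e)
        = (\<Sum>v\<in>verts G. \<Sum>e\<in>{e \<in> edges G. u \<in> e}. if e = {v, \<sigma> v} then 1/2 else 0)"
      unfolding g_def by (rule sum.swap)
    also have "\<dots> = (\<Sum>v\<in>verts G. (if v = u then 1/2 else 0) + (if \<sigma> v = u then 1/2 else 0))"
    proof (rule sum.cong[OF refl])
      fix v assume v: "v \<in> verts G"
      have "v \<noteq> \<sigma> v" using simple_graph_edgeD(3)[OF G adj[OF v]] .
      then show "(\<Sum>e\<in>{e \<in> edges G. u \<in> e}. if e = {v, \<sigma> v} then 1/2 else 0)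
          = (if v = u then 1/2 else 0) + (if \<sigma> v = u then 1/2 else (0::real))"
        using fin adj[OF v] by (auto simp: sum.delta)
    qed
    also have "\<dots> = 1/2 + (\<Sum>v\<in>verts G. if \<sigma> v = u then 1/2 else 0)"
      using fin u by (simp add: sum.distrib)
    also have "(\<Sum>v\<in>verts G. if \<sigma> v = u then 1/2 else 0) = (\<Sum>w\<in>verts G. if w = u then 1/2 else (0::real))"
      using sum.reindex_bij_betw[OF bij, of "\<lambda>w. if w = u then 1/2 else (0::real)"] .
    finally show ?thesis using fin u by simp
  qed
  \<comment> \<open>A single nonnegative term is at most the total 1 at an end of
    \<open>e\<close>.\<close>
  have "g e \<le> 1" if e: "e \<in> edges G" for e
  proof -
    obtain u where u: "u \<in> e" "u \<in> verts G"
      using G e by (metis card.empty equals0I simple_graph_def subsetD zero_neq_numeral)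
    have "g e \<le> (\<Sum>e\<in>{e \<in> edges G. u \<in> e}. g e)"
      using e u fin nonneg by (intro member_le_sum) auto
    then show ?thesis using total u by simp
  qed
  then show ?thesis
    unfolding has_fpm_def fractional_perfect_matching_def using nonneg total by blast
qed

text \<open>Transports a permutation of list positions to the vertices, so that the later
  permutations can be given by arithmetic on indices. On the finite range of positions injectivity
  already yields a bijection.\<close>

lemma has_fpm_if_list_permutation:
  assumes G: "simple_graph G" and p: "distinct p" "set p = verts G"
    and inj: "inj_on \<pi> {..<length p}"
    and adj: "\<And>i. i < length p \<Longrightarrow> \<pi> i < length p \<and> {p ! i, p ! \<pi> i} \<in> edges G"
  shows "has_fpm G"
proof -
  let ?I = "{..<length p}"
  have nth: "bij_betw ((!) p) ?I (verts G)"
    using bij_betw_nth[OF p(1) refl] p(2) by simp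
  have "\<pi> ` ?I = ?I"
    using inj adj by (intro endo_inj_surj) auto
  then have \<pi>: "bij_betw \<pi> ?I ?I" using inj by (simp add: bij_betw_def)
  define \<sigma> where "\<sigma> = (!) p \<circ> (\<pi> \<circ> inv_into ?I ((!) p))"
  have bij: "bij_betw \<sigma> (verts G) (verts G)"
    unfolding \<sigma>_def
    by (rule bij_betw_trans[OF bij_betw_trans[OF bij_betw_inv_into[OF nth] \<pi>] nth])
  have "{v, \<sigma> v} \<in> edges G" if "v \<in> verts G" for v
  proof -
    have "v \<in> set p" using that p(2) by simp
    then obtain i where i: "i < length p" "v = p ! i"
      by (auto simp: in_set_conv_nth)
    have "inv_into ?I ((!) p) v = i"
      unfolding i(2) by (rule inv_into_f_f) (use i nth in \<open>auto simp: bij_betw_def\<close>)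
    then show ?thesis
      using adj[OF i(1)] i(2) by (simp add: \<sigma>_def)
  qed
  then show ?thesis by (rule has_fpm_if_permutation[OF G bij])
qed

text \<open>The successor map along the cycle is the required permutation.\<close>

lemma has_fpm_if_hamiltonian:
  assumes "simple_graph G" "hamiltonian G"
  shows "has_fpm G"
proof -
  obtain p where p: "3 \<le> length p" "distinct p" "cycle_edges p \<subseteq> edges G" "set p = verts G"
    using assms(2) by (auto simp: hamiltonian_def is_cycle_def)
  show ?thesis
  proof (rule has_fpm_if_list_permutation[OF assms(1) p(2,4), of "\<lambda>i. Suc i mod length p"])
    show "inj_on (\<lambda>i. Suc i mod length p) {..<length p}"
      by (auto simp: inj_on_def mod_Suc split: if_splits)
    show "Suc i mod length p < length p \<and> {p ! i, p ! (Suc i mod length p)} \<in> edges G"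
      if "i < length p" for i
      using p(1,3) that by (auto simp: cycle_edges_def intro!: mod_less_divisor)
  qed
qed

section \<open>Hamiltonian paths and fractional perfect matchings\<close>

definition hamiltonian_path :: "'a graph \<Rightarrow> 'a list \<Rightarrow> bool" where
  "hamiltonian_path G p \<longleftrightarrow> distinct p \<and> set p = verts G \<and>
     (\<forall>i. Suc i < length p \<longrightarrow> {p ! i, p ! Suc i} \<in> edges G)"

text \<open>The involution swapping positions \<open>2 * k\<close> and \<open>2 * k + 1\<close>
  matches the path by every other edge.\<close>

lemma has_fpm_if_even_path:
  assumes G: "simple_graph G" and p: "hamiltonian_path G p" "even (length p)"
  shows "has_fpm G"
proof (rule has_fpm_if_list_permutation[OF G])
  let ?\<pi> = "\<lambda>i::nat. if even i then Suc i else i - 1"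
  have "?\<pi> (?\<pi> i) = i" for i by (auto elim: oddE)
  then show "inj_on ?\<pi> {..<length p}" by (rule inj_on_inverseI)
  fix i assume i: "i < length p"
  show "?\<pi> i < length p \<and> {p ! i, p ! ?\<pi> i} \<in> edges G"
  proof (cases "even i")
    case True
    then have "Suc i < length p" using i p(2) by (metis Suc_lessI even_Suc)
    then show ?thesis using True p(1) by (simp add: hamiltonian_path_def)
  next
    case False
    then obtain j where "i = Suc j" by (metis even_zero not0_implies_Suc)
    then show ?thesis using False i p(1) by (auto simp: hamiltonian_path_def insert_commute)
  qed
qed (use p in \<open>auto simp: hamiltonian_path_def\<close>)

text \<open>The chord closes an odd cycle, and the two ends of the path that it cuts off have even length.\<close>

lemma has_fpm_if_path_chord:
  assumes G: "simple_graph G" and p: "hamiltonian_path G p" "odd (length p)"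
    and ij: "even i" "even j" "i < j" "j < length p" "{p ! i, p ! j} \<in> edges G"
  shows "has_fpm G"
proof -
  \<comment> \<open>Positions before \<open>i\<close> are paired from 0 on, the block from
    \<open>i\<close> to \<open>j\<close> is rotated along the odd cycle, and positions after
    \<open>j\<close> are paired from \<open>j + 1\<close> on. The map \<open>?\<rho>\<close> below
    undoes each of the three pieces.\<close>
  define \<pi> where "\<pi> k = (if k < i then (if even k then Suc k else k - 1)
     else if k < j then Suc k else if k = j then i
     else (if odd k then Suc k else k - 1))" for k
  let ?\<rho> = "\<lambda>k. if k < i then (if even k then Suc k else k - 1)
     else if k = i then j else if k \<le> j then k - 1
     else (if odd k then Suc k else k - 1)"
  have "?\<rho> (\<pi> k) = k" for k
  proof -
    consider "k < i" | "i \<le> k" "k < j" | "k = j" | "j < k" by linarith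
    then show ?thesis
    proof cases
      case 1
      then have "even k \<Longrightarrow> Suc k < i" using ij(1) by (metis Suc_lessI even_Suc)
      then show ?thesis using 1 by (auto simp: \<pi>_def elim: oddE)
    next
      case 4
      \<comment> \<open>Both \<open>k\<close> and \<open>j\<close> are even, so \<open>k\<close> is
        not \<open>j + 1\<close> and its partner \<open>k - 1\<close> stays behind the
        block.\<close>
      then have "even k \<Longrightarrow> j < k - 1" using ij(2) by presburger
      then show ?thesis using 4 ij(3) by (auto simp: \<pi>_def elim: evenE)
    qed (use ij(3) in \<open>auto simp: \<pi>_def\<close>)
  qed
  then have inj: "inj_on \<pi> {..<length p}" by (rule inj_on_inverseI)
  have step: "\<pi> k < length p \<and> {p ! k, p ! \<pi> k} \<in> edges G" if k: "k < length p" for k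
  proof -
    have adj: "{p ! i, p ! Suc i} \<in> edges G" if "Suc i < length p" for i
      using p(1) that by (simp add: hamiltonian_path_def)
    consider "\<pi> k = Suc k" "Suc k < length p" | l where "k = Suc l" "\<pi> k = l" | "k = j" "\<pi> k = i"
    proof -
      have odd_pred: "k = Suc (k - 1)" if "odd k" using that by (simp add: odd_pos)
      consider "k < i" | "i \<le> k" "k < j" | "k = j" | "j < k" by linarith
      then show ?thesis
      proof cases
        case 1
        show ?thesis
        proof (cases "even k")
          case True
          show ?thesis by (rule that(1)) (use True 1 ij(3,4) in \<open>auto simp: \<pi>_def\<close>)
        next
          case False
          show ?thesis by (rule that(2)[OF odd_pred[OF False]]) (use False 1 in \<open>simp add: \<pi>_def\<close>)
        qed
      next
        case 2
        show ?thesis by (rule that(1)) (use 2 ij(4) in \<open>auto simp: \<pi>_def\<close>)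
      next
        case 3
        show ?thesis by (rule that(3)) (use 3 ij(3) in \<open>auto simp: \<pi>_def\<close>)
      next
        case 4
        show ?thesis
        proof (cases "odd k")
          case True
          \<comment> \<open>The last position is even because the length is odd, so an odd
            \<open>k\<close> always has its partner to the right.\<close>
          then have "Suc k \<noteq> length p" using p(2) by (metis even_Suc)
          then show ?thesis by (intro that(1)) (use True 4 ij(3) k in \<open>auto simp: \<pi>_def\<close>)
        next
          case False
          show ?thesis by (rule that(2)[of "k - 1"]) (use False 4 ij(3) in \<open>auto simp: \<pi>_def\<close>)
        qed
      qed
    qed
    then show ?thesis
    proof cases
      case 1
      then show ?thesis using adj[OF 1(2)] by metis
    next
      case 2
      then show ?thesis using adj[of l] k by (metis Suc_lessD insert_commute)
    next
      case 3
      then show ?thesis using ij(3-5) by (metis insert_commute less_trans)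
    qed
  qed
  show ?thesis
    using has_fpm_if_list_permutation[OF G _ _ inj step] p by (auto simp: hamiltonian_path_def)
qed

text \<open>The even positions of a path with \<open>2 * m + 1\<close> vertices number
  \<open>m + 1\<close>, and an edge between two of them would be a chord that yields a fractional
  perfect matching.\<close>

lemma hamiltonian_path_no_fpm:
  assumes G: "simple_graph G" and p: "hamiltonian_path G p" and no: "\<not> has_fpm G"
  obtains S where "independent_set G S" "2 * card S = card (verts G) + 1"
proof -
  have odd: "odd (length p)" using has_fpm_if_even_path[OF G p] no by blast
  then obtain m where m: "length p = 2 * m + 1" by (rule oddE)
  define S where "S = (\<lambda>k. p ! (2 * k)) ` {..m}"
  have pv: "distinct p" "set p = verts G" using p by (auto simp: hamiltonian_path_def)
  have "inj_on (\<lambda>k. p ! (2 * k)) {..m}"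
    using pv(1) m by (auto simp: inj_on_def nth_eq_iff_index_eq)
  then have "card S = m + 1" unfolding S_def by (simp add: card_image)
  moreover have "card (verts G) = 2 * m + 1" using pv m by (metis distinct_card)
  moreover have "independent_set G S"
    unfolding independent_set_def
  proof (intro conjI ballI notI)
    show "S \<subseteq> verts G" using m pv(2) by (auto simp: S_def intro!: nth_mem)
    fix e assume e: "e \<in> edges G" "e \<subseteq> S"
    then have "card e = 2" using G by (simp add: simple_graph_def)
    then obtain x y where xy: "e = {x, y}" "x \<noteq> y" by (auto simp: card_2_iff)
    then obtain i j where ij: "x = p ! (2 * i)" "y = p ! (2 * j)" "i \<le> m" "j \<le> m"
      using e(2) by (auto simp: S_def)
    have *: False if "k < l" "l \<le> m" "{p ! (2 * k), p ! (2 * l)} \<in> edges G" for k l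
      using has_fpm_if_path_chord[OF G p odd, of "2 * k" "2 * l"] that m no by simp
    have "i \<noteq> j" using xy ij by auto
    then show False
      using *[of i j] *[of j i] e(1) xy(1) ij by (metis insert_commute nat_neq_iff)
  qed
  ultimately show ?thesis using that by simp
qed

section \<open>From faults to a large set with few inner edges\<close>

lemma delete_delete: "delete (delete G A) B = delete G (A \<union> B)"
  by (auto simp: delete_def)

text \<open>Allows a cycle to be cut open at any place.\<close>

lemma rotate_cycle_adjacent:
  assumes "is_cycle G vs" "Suc i < length vs"
  shows "{rotate k vs ! i, rotate k vs ! Suc i} \<in> edges G"
proof -
  have "rotate k vs ! i = vs ! ((k + i) mod length vs)"
    "rotate k vs ! Suc i = vs ! (Suc ((k + i) mod length vs) mod length vs)"
    using assms(2) by (simp_all add: nth_rotate mod_Suc_eq)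
  moreover have "(k + i) mod length vs < length vs" using assms(2) by (intro mod_less_divisor) linarith
  ultimately show ?thesis
    using assms(1) by (auto simp: is_cycle_def cycle_edges_def)
qed

text \<open>The cycle is rotated so that the deleted element sits at the seam: a vertex comes first
  and is dropped, an edge of the cycle joins the last entry to the first.\<close>

lemma hamiltonian_path_delete1:
  assumes "hamiltonian G" "x \<in> verts G <+> edges G"
  obtains p where "hamiltonian_path (delete G {x}) p"
proof -
  obtain vs where vs: "is_cycle G vs" "set vs = verts G"
    using assms(1) by (auto simp: hamiltonian_def)
  define n where "n = length vs"
  have n: "n \<ge> 3" and dist: "distinct vs"
    using vs(1) by (auto simp: is_cycle_def n_def)
  from assms(2) consider v where "x = Inl v" "v \<in> verts G" | e where "x = Inr e" by blast
  then show ?thesis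
  proof cases
    case (1 v)
    then obtain k where k: "k < n" "vs ! k = v"
      using vs(2) by (metis in_set_conv_nth n_def)
    define w where "w = rotate k vs"
    have w: "length w = n" "distinct w" "set w = verts G"
      using dist vs(2) by (simp_all add: w_def n_def)
    have "w ! 0 = v"
      using k nth_rotate[of 0 vs k] unfolding w_def n_def by fastforce
    then obtain p where p: "w = v # p" using n w(1) by (cases w) auto
    have "hamiltonian_path (delete G {x}) p"
      unfolding hamiltonian_path_def
    proof (intro conjI allI impI)
      show "distinct p" using w p by simp
      show "set p = verts (delete G {x})" using w p 1 by (auto simp: delete_def)
      fix i assume i: "Suc i < length p"
      have "{w ! Suc i, w ! Suc (Suc i)} \<in> edges G"
        unfolding w_def using i p w n_def by (intro rotate_cycle_adjacent[OF vs(1)]) auto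
      moreover have "p ! i \<noteq> v" "p ! Suc i \<noteq> v" using w(2) p i by (metis Suc_lessD distinct.simps(2) nth_mem)+
      ultimately show "{p ! i, p ! Suc i} \<in> edges (delete G {x})"
        using p 1 by (auto simp: delete_def)
    qed
    then show ?thesis by (rule that)
  next
    case (2 e)
    obtain k where k: "\<And>i. Suc i < n \<Longrightarrow> {rotate k vs ! i, rotate k vs ! Suc i} \<noteq> e"
    proof (cases "e \<in> cycle_edges vs")
      case False
      have "{rotate 0 vs ! i, rotate 0 vs ! Suc i} \<noteq> e" if "Suc i < n" for i
        using False that by (force simp: cycle_edges_def n_def)
      then show ?thesis by (rule that)
    next
      case True
      then obtain j where j: "j < n" "e = {vs ! j, vs ! (Suc j mod n)}"
        by (auto simp: cycle_edges_def n_def)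
      \<comment> \<open>The edge \<open>e\<close> leaves position \<open>j\<close>, so starting the
        list at position \<open>j + 1\<close> moves \<open>e\<close> to the wrap-around.\<close>
      define w where "w = rotate (Suc j) vs"
      have w: "length w = n" "distinct w" using dist by (simp_all add: w_def n_def)
      have rot: "w ! i = vs ! ((Suc j + i) mod n)" if "i < n" for i
        unfolding w_def n_def using that nth_rotate[of i vs "Suc j"] by (simp only: n_def)
      have "Suc j + (n - 1) = j + n" using n by simp
      then have "(Suc j + (n - 1)) mod n = j" using j(1) by simp
      then have "w ! 0 = vs ! (Suc j mod n)" "w ! (n - 1) = vs ! j"
        using n rot[of 0] rot[of "n - 1"] by simp_all
      then have e: "e = {w ! 0, w ! (n - 1)}" using j(2) by auto
      \<comment> \<open>With at least three vertices the first and last positions are not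
        consecutive.\<close>
      have "{w ! i, w ! Suc i} \<noteq> e" if "Suc i < n" for i
        unfolding e using that n w by (auto simp: doubleton_eq_iff nth_eq_iff_index_eq)
      then show ?thesis using that unfolding w_def by blast
    qed
    have "hamiltonian_path (delete G {x}) (rotate k vs)"
      unfolding hamiltonian_path_def
      using dist vs(2) 2 k rotate_cycle_adjacent[OF vs(1)] by (auto simp: delete_def n_def)
    then show ?thesis by (rule that)
  qed
qed

text \<open>Restoring one element of \<open>F\<close> brings the number of faults down to
  \<open>\<delta> - 2\<close>, where a Hamiltonian cycle exists; deleting it again leaves a
  Hamiltonian path. The independent set of \<open>delete G F\<close> found on this path is then read
  in \<open>G\<close>.\<close>

lemma no_fpm_obtains_independent_set:
  assumes G: "simple_graph G" and fault: "fault_hamiltonian (\<delta> - 2) G" and \<delta>: "\<delta> \<ge> 2"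
    and F: "F \<subseteq> verts G <+> edges G" "card F < \<delta>" and no: "\<not> has_fpm (delete G F)"
  obtains S where "S \<subseteq> verts G" "2 * card S + card (Inl -` F) = card (verts G) + 1"
    "card {e \<in> edges G. e \<subseteq> S} + card (Inl -` F) < \<delta>"
proof -
  have fin: "finite (verts G)" "finite (edges G)"
    using G simple_graph_finite_edges by (auto simp: simple_graph_def)
  have finF: "finite F" using F(1) fin by (meson finite_Plus finite_subset)
  have "hamiltonian (delete G F)" if "card F \<le> \<delta> - 2"
    using fault F(1) that by (auto simp: fault_hamiltonian_def)
  \<comment> \<open>Any smaller \<open>F\<close> would leave a Hamiltonian cycle and hence a
    fractional perfect matching.\<close>
  then have cF: "card F = \<delta> - 1"
    using no F(2) has_fpm_if_hamiltonian[OF simple_graph_delete[OF G]] by fastforce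
  then obtain x where x: "x \<in> F" using \<delta> by fastforce
  define F' where "F' = F - {x}"
  have "card F' \<le> \<delta> - 2" using x finF cF by (simp add: F'_def)
  then have H: "hamiltonian (delete G F')"
    using fault F(1) unfolding fault_hamiltonian_def F'_def by blast
  have F: "F' \<union> {x} = F" using x by (auto simp: F'_def)
  obtain p where p: "hamiltonian_path (delete G F) p"
  proof (cases "x \<in> verts (delete G F') <+> edges (delete G F')")
    case True
    then show ?thesis
      using hamiltonian_path_delete1[OF H True] that by (metis F delete_delete)
  next
    case False
    text \<open>Here \<open>x\<close> is an edge at a vertex of \<open>F'\<close>, so deleting it changes nothing.\<close>
    then have "delete G F = delete G F'"
      using x assms(4) by (auto simp: delete_def F'_def)
    then have "hamiltonian (delete G F)" using H by simp
    then show ?thesis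
      using no has_fpm_if_hamiltonian[OF simple_graph_delete[OF G]] by blast
  qed
  obtain S where S: "independent_set (delete G F) S" "2 * card S = card (verts (delete G F)) + 1"
    using hamiltonian_path_no_fpm[OF simple_graph_delete[OF G] p no] .
  have SV: "S \<subseteq> verts G" using S(1) by (auto simp: independent_set_def delete_def)
  have fins: "finite (Inl -` F)" "finite (Inr -` F)" using finF by (simp_all add: finite_vimageI)
  have "F = (Inl -` F) <+> (Inr -` F)" by (rule set_eqI, case_tac x) auto
  then have "card F = card (Inl -` F) + card (Inr -` F)"
    using card_Plus[OF fins] by metis
  \<comment> \<open>No vertex of \<open>S\<close> is deleted, so an edge of \<open>G\<close> inside
    \<open>S\<close> can only be missing by being a fault itself.\<close>
  moreover have "{e \<in> edges G. e \<subseteq> S} \<subseteq> Inr -` F"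
    using S(1) by (fastforce simp: independent_set_def delete_def)
  then have "card {e \<in> edges G. e \<subseteq> S} \<le> card (Inr -` F)" using fins by (simp add: card_mono)
  ultimately have "card {e \<in> edges G. e \<subseteq> S} + card (Inl -` F) < \<delta>"
    using assms(5) by simp
  moreover have VF: "Inl -` F \<subseteq> verts G" using assms(4) by auto
  moreover have "verts (delete G F) = verts G - Inl -` F" by (auto simp: delete_def)
  then have "card (verts (delete G F)) + card (Inl -` F) = card (verts G)"
    using fin(1) fins VF by (simp add: card_Diff_subset card_mono)
  ultimately show ?thesis using that[OF SV] S(2) by simp
qed

section \<open>Independence number and edge counts\<close>

lemma independent_set_card_le:
  assumes "simple_graph G" "independent_set G S"
  shows "card S \<le> independence_number G"
proof -
  have "finite (card ` Pow (verts G))" using assms(1) by (simp add: simple_graph_def)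
  then have "finite {card S |S. independent_set G S}"
    by (rule rev_finite_subset) (auto simp: independent_set_def)
  then show ?thesis
    unfolding independence_number_def by (rule Max_ge) (use assms(2) in blast)
qed

text \<open>Removing one endpoint of each edge inside a vertex set leaves an independent set.\<close>

lemma card_le_independence_number:
  assumes G: "simple_graph G" and S: "S \<subseteq> verts G"
  shows "card S \<le> independence_number G + card {e \<in> edges G. e \<subseteq> S}"
proof -
  have fin: "finite (verts G)" "finite (edges G)" "finite S"
    using G simple_graph_finite_edges S by (auto simp: simple_graph_def intro: finite_subset)
  define X where "X = {e \<in> edges G. e \<subseteq> S}"
  define C where "C = (\<lambda>e. SOME v. v \<in> e) ` X"
  have pick: "(SOME v. v \<in> e) \<in> e" if "e \<in> edges G" for e
  proof -
    have "e \<noteq> {}" using that G by (force simp: simple_graph_def)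
    then show ?thesis by (simp add: some_in_eq)
  qed
  have "\<not> e \<subseteq> S - C" if e: "e \<in> edges G" for e
    using pick[OF e] e by (auto simp: C_def X_def)
  then have "independent_set G (S - C)"
    using S by (auto simp: independent_set_def)
  then have "card (S - C) \<le> independence_number G" by (rule independent_set_card_le[OF G])
  moreover have "card S \<le> card (S - C) + card C"
    using diff_card_le_card_Diff[of C S] fin by (simp add: C_def X_def)
  moreover have "card C \<le> card X" unfolding C_def using fin by (simp add: X_def card_image_le)
  ultimately show ?thesis by (simp add: X_def)
qed

lemma sum_degree:
  assumes G: "simple_graph G" and S: "S \<subseteq> verts G"
  shows "(\<Sum>v\<in>S. degree G v) = (\<Sum>e\<in>edges G. card (e \<inter> S))"
proof -
  have fin: "finite S" "finite (edges G)"
    using G simple_graph_finite_edges S by (auto simp: simple_graph_def intro: finite_subset)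
  have "(\<Sum>v\<in>S. degree G v) = (\<Sum>v\<in>S. \<Sum>e\<in>edges G. if v \<in> e then 1 else 0)"
    using fin by (simp add: degree_def sum.If_cases Int_def)
  also have "\<dots> = (\<Sum>e\<in>edges G. \<Sum>v\<in>S. if v \<in> e then 1 else 0)" by (rule sum.swap)
  also have "\<dots> = (\<Sum>e\<in>edges G. card (e \<inter> S))"
    using fin by (simp add: sum.If_cases Int_def conj_commute)
  finally show ?thesis .
qed

text \<open>Compare the degree sums of \<open>S\<close> and its complement edge by edge: a cut edge
  contributes equally to both, an inner edge contributes 2 to its own side only. Correction terms on
  both sides avoid subtraction of naturals.\<close>

lemma regular_balance:
  assumes G: "simple_graph G" and reg: "regular k G" and S: "S \<subseteq> verts G"
  shows "k * card S + 2 * card {e \<in> edges G. e \<subseteq> verts G - S}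
       = k * card (verts G - S) + 2 * card {e \<in> edges G. e \<subseteq> S}"
proof -
  let ?R = "verts G - S"
  have fin: "finite (verts G)" "finite (edges G)"
    using G simple_graph_finite_edges S by (auto simp: simple_graph_def)
  have deg: "k * card A = (\<Sum>e\<in>edges G. card (e \<inter> A))" if "A \<subseteq> verts G" for A
    using sum_degree[OF G that] reg that by (simp add: regular_def subset_iff mult.commute)
  have edge: "card (e \<inter> S) + 2 * (if e \<subseteq> ?R then 1 else 0) = card (e \<inter> ?R) + 2 * (if e \<subseteq> S then 1 else 0)"
    if "e \<in> edges G" for e
  proof -
    have e: "e \<subseteq> verts G" "card e = 2" using that G by (auto simp: simple_graph_def)
    obtain a b where "e = {a, b}" "a \<noteq> b" using e(2) by (auto simp: card_2_iff)
    with e(1) show ?thesis by (auto simp: Int_insert_left)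
  qed
  have count: "card {e \<in> edges G. e \<subseteq> A} = (\<Sum>e\<in>edges G. if e \<subseteq> A then 1 else 0)" for A
    using fin by (simp add: sum.If_cases Int_def)
  show ?thesis
    unfolding deg[OF S] deg[OF Diff_subset] count sum_distrib_left sum.distrib[symmetric]
    by (rule sum.cong[OF refl edge])
qed

section \<open>Triangle weights and cut edges\<close>

text \<open>Counting oriented edges lets a triangle be treated as a triple with a cyclic
  rotation.\<close>

lemma card_ordered_pairs:
  assumes "finite X" "\<And>e. e \<in> X \<Longrightarrow> card e = 2"
  shows "finite {(a, b). {a, b} \<in> X}" "card {(a, b). {a, b} \<in> X} = 2 * card X"
proof -
  have *: "{(a, b). {a, b} \<in> X} = (\<Union>e\<in>X. {(a, b). {a, b} = e})" by auto
  have two: "finite {(a, b). {a, b} = e} \<and> card {(a, b). {a, b} = e} = 2" if e: "e \<in> X" for e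
  proof -
    obtain a b where "e = {a, b}" "a \<noteq> b" using assms(2)[OF e] by (auto simp: card_2_iff)
    then have "{(x, y). {x, y} = e} = {(a, b), (b, a)}" "(a, b) \<noteq> (b, a)"
      by (auto simp: doubleton_eq_iff)
    then show ?thesis by simp
  qed
  show "finite {(a, b). {a, b} \<in> X}" unfolding * using assms(1) two by blast
  have "card (\<Union>e\<in>X. {(a, b). {a, b} = e}) = (\<Sum>e\<in>X. card {(a, b). {a, b} = e})"
    using assms(1) two by (intro card_UN_disjoint) auto
  then show "card {(a, b). {a, b} \<in> X} = 2 * card X" unfolding * using two by simp
qed

text \<open>
  Each edge spreads weight 1 evenly over the triangles containing it. Since \<open>G\<close> has no induced
  \<open>K\<^sub>4 - e\<close>, the three edges of a triangle lie in equally many triangles. So the three edges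
  give the same share to each of their triangles, and one of the three is not cut by \<open>S\<close>.
\<close>

lemma edges_le_thrice_uncut:
  assumes G: "simple_graph G" and S: "S \<subseteq> verts G"
    and diamond: "\<And>a b c d. {a, b} \<in> edges G \<Longrightarrow> {a, c} \<in> edges G \<Longrightarrow> {b, c} \<in> edges G \<Longrightarrow>
      {a, d} \<in> edges G \<Longrightarrow> {b, d} \<in> edges G \<Longrightarrow> c \<noteq> d \<Longrightarrow> {c, d} \<in> edges G"
    and triangle: "\<And>a b. {a, b} \<in> edges G \<Longrightarrow> \<exists>c. {a, c} \<in> edges G \<and> {b, c} \<in> edges G"
  shows "card (edges G)
    \<le> 3 * (card {e \<in> edges G. e \<subseteq> S} + card {e \<in> edges G. e \<subseteq> verts G - S})"
proof -
  define adj where "adj a b \<longleftrightarrow> {a, b} \<in> edges G" for a b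
  have sym: "adj a b \<longleftrightarrow> adj b a" for a b by (simp add: adj_def insert_commute)
  have irrefl: "\<not> adj a a" for a
    using simple_graph_edgeD(3)[OF G] unfolding adj_def by blast
  have adjV: "a \<in> verts G" "b \<in> verts G" if "adj a b" for a b
    using simple_graph_edgeD[OF G] that unfolding adj_def by blast+
  have fin: "finite (verts G)" "finite (edges G)"
    using G simple_graph_finite_edges by (auto simp: simple_graph_def)
  define N where "N p = {c. adj (fst p) c \<and> adj (snd p) c}" for p
  have finN: "finite (N p)" for p
    by (rule finite_subset[OF _ fin(1)]) (use adjV in \<open>auto simp: N_def\<close>)
  \<comment> \<open>The common neighbours of the ends of \<open>p\<close> are the third corners of
    its triangles, so \<open>\<tau> p\<close> counts the triangles on \<open>p\<close>.\<close>
  define \<tau> where "\<tau> p = real (card (N p))" for p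
  have \<tau>_pos: "\<tau> (a, b) > 0" if "adj a b" for a b
  proof -
    have "N (a, b) \<noteq> {}" using triangle[of a b] that by (auto simp: N_def adj_def)
    then show ?thesis using finN by (simp add: \<tau>_def card_gt_0_iff)
  qed
  \<comment> \<open>A further common neighbour of two corners is adjacent to the third by
    \<open>diamond\<close>, so each side of the triangle has the same common neighbours outside the
    triangle.\<close>
  have \<tau>_shift: "\<tau> (a, b) = \<tau> (b, c)" if t: "adj a b" "adj b c" "adj c a" for a b c
  proof -
    have "N (a, b) - {c} \<subseteq> N (b, c) - {a}"
    proof
      fix d assume "d \<in> N (a, b) - {c}"
      then have d: "adj a d" "adj b d" "d \<noteq> c" by (auto simp: N_def)
      then have "adj c d" using diamond[of a b c d] t sym unfolding adj_def by blast
      then show "d \<in> N (b, c) - {a}" using d irrefl by (auto simp: N_def)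
    qed
    moreover have "N (b, c) - {a} \<subseteq> N (a, b) - {c}"
    proof
      fix d assume "d \<in> N (b, c) - {a}"
      then have d: "adj b d" "adj c d" "d \<noteq> a" by (auto simp: N_def)
      then have "adj a d" using diamond[of b c a d] t sym unfolding adj_def by blast
      then show "d \<in> N (a, b) - {c}" using d irrefl by (auto simp: N_def)
    qed
    ultimately have "N (a, b) - {c} = N (b, c) - {a}" by (rule subset_antisym)
    moreover have "c \<in> N (a, b)" "a \<in> N (b, c)" using t sym by (auto simp: N_def)
    ultimately have "card (N (a, b)) = card (N (b, c))"
      using finN by (metis card.remove)
    then show ?thesis by (simp add: \<tau>_def)
  qed
  define D where "D = {(a, b). adj a b}"
  define T where "T = Sigma D N"
  have Tmem: "((a, b), c) \<in> T \<longleftrightarrow> adj a b \<and> adj b c \<and> adj c a" for a b c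
    using sym by (auto simp: T_def D_def N_def)
  have D: "finite D" "card D = 2 * card (edges G)"
    using card_ordered_pairs[OF fin(2)] G by (auto simp: D_def adj_def simple_graph_def)
  \<comment> \<open>The weight of each oriented edge is shared equally among its triangles.\<close>
  have spread: "(\<Sum>p\<in>D. f p) = (\<Sum>t\<in>T. f (fst t) / \<tau> (fst t))" for f :: "_ \<Rightarrow> real"
  proof -
    have "(\<Sum>p\<in>D. f p) = (\<Sum>p\<in>D. \<Sum>c\<in>N p. f p / \<tau> p)"
    proof (rule sum.cong[OF refl])
      fix p assume "p \<in> D"
      then have "\<tau> p \<noteq> 0" using \<tau>_pos[of "fst p" "snd p"] by (auto simp: D_def)
      then show "f p = (\<Sum>c\<in>N p. f p / \<tau> p)" by (simp add: \<tau>_def)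
    qed
    also have "\<dots> = (\<Sum>(p, c)\<in>T. f p / \<tau> p)"
      unfolding T_def by (rule sum.Sigma) (use D(1) finN in auto)
    finally show ?thesis by (simp add: case_prod_unfold)
  qed
  \<comment> \<open>The indicator of not being cut by \<open>S\<close>.\<close>
  define m where "m p = (if (fst p \<in> S) = (snd p \<in> S) then 1 else 0 :: real)" for p
  define rot where "rot t = ((snd (fst t), snd t), fst (fst t))" for t :: "('a \<times> 'a) \<times> 'a"
  have rot_T: "rot t \<in> T" "\<tau> (fst (rot t)) = \<tau> (fst t)" if "t \<in> T" for t
  proof -
    obtain a b c where t: "t = ((a, b), c)" by (metis surj_pair)
    then have "adj a b" "adj b c" "adj c a" using that Tmem by auto
    then show "rot t \<in> T" "\<tau> (fst (rot t)) = \<tau> (fst t)"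
      using \<tau>_shift[of a b c] by (simp_all add: t rot_def Tmem)
  qed
  have "bij_betw rot T T"
    by (rule bij_betw_byWitness[of _ "rot \<circ> rot"]) (use rot_T in \<open>auto simp: rot_def\<close>)
  note reindex = sum.reindex_bij_betw[OF this]
  \<comment> \<open>Since \<open>\<tau>\<close> is constant along rotations, all three sides of the
    oriented triangles give the same weighted sum. The cases used are \<open>r\<close> the identity
    and \<open>r = rot\<close>.\<close>
  have rotate: "(\<Sum>t\<in>T. m (fst (rot (r t))) / \<tau> (fst t)) = (\<Sum>t\<in>T. m (fst (r t)) / \<tau> (fst t))"
    if r: "\<And>t. rot (r t) = r (rot t)" for r
  proof -
    have "(\<Sum>t\<in>T. m (fst (rot (r t))) / \<tau> (fst t)) = (\<Sum>t\<in>T. m (fst (r (rot t))) / \<tau> (fst (rot t)))"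
      by (rule sum.cong) (simp_all add: r rot_T)
    then show ?thesis using reindex[of "\<lambda>t. m (fst (r t)) / \<tau> (fst t)"] by simp
  qed
  have "real (card D) = (\<Sum>t\<in>T. 1 / \<tau> (fst t))"
    using spread[of "\<lambda>_. 1"] by simp
  also have "\<dots> \<le> (\<Sum>t\<in>T. m (fst t) / \<tau> (fst t) + m (fst (rot t)) / \<tau> (fst t)
      + m (fst (rot (rot t))) / \<tau> (fst t))"
  proof (rule sum_mono)
    fix t assume "t \<in> T"
    then have "\<tau> (fst t) > 0"
      using \<tau>_pos[of "fst (fst t)" "snd (fst t)"] by (auto simp: T_def D_def)
    \<comment> \<open>Two of the three corners lie on the same side of \<open>S\<close>.\<close>
    moreover have "1 \<le> m (fst t) + m (fst (rot t)) + m (fst (rot (rot t)))"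
      by (auto simp: m_def rot_def)
    ultimately have "1 / \<tau> (fst t) \<le> (m (fst t) + m (fst (rot t)) + m (fst (rot (rot t)))) / \<tau> (fst t)"
      by (intro divide_right_mono) auto
    then show "1 / \<tau> (fst t) \<le> m (fst t) / \<tau> (fst t) + m (fst (rot t)) / \<tau> (fst t)
      + m (fst (rot (rot t))) / \<tau> (fst t)"
      by (simp add: add_divide_distrib)
  qed
  also have "\<dots> = 3 * (\<Sum>t\<in>T. m (fst t) / \<tau> (fst t))"
    using rotate[of "\<lambda>t. t"] rotate[of rot] by (simp add: sum.distrib)
  also have "\<dots> = 3 * (\<Sum>p\<in>D. m p)" using spread[of m] by simp
  also have "(\<Sum>p\<in>D. m p) = real (card {p \<in> D. (fst p \<in> S) = (snd p \<in> S)})"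
    using D(1) by (simp add: m_def sum.If_cases Int_def)
  finally have main: "card D \<le> 3 * card {p \<in> D. (fst p \<in> S) = (snd p \<in> S)}" by linarith
  define X where "X = {e \<in> edges G. e \<subseteq> S}"
  define Y where "Y = {e \<in> edges G. e \<subseteq> verts G - S}"
  have "{p \<in> D. (fst p \<in> S) = (snd p \<in> S)} = {(a, b). {a, b} \<in> X \<union> Y}"
    using adjV by (auto simp: X_def Y_def D_def adj_def)
  moreover have "card {(a, b). {a, b} \<in> X \<union> Y} = 2 * card (X \<union> Y)"
    by (rule card_ordered_pairs) (use fin G in \<open>auto simp: X_def Y_def simple_graph_def\<close>)
  moreover have "card (X \<union> Y) \<le> card X + card Y" by (rule card_Un_le)
  ultimately show ?thesis using main D(2) by (simp add: X_def Y_def)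
qed

section \<open>Evaluating \<open>fsmp\<close> and \<open>fmp\<close>\<close>

text \<open>The vertex survives but becomes isolated, so its weights sum to 0.\<close>

lemma no_fpm_delete_star:
  assumes "v \<in> verts G"
  shows "\<not> has_fpm (delete G (Inr ` {e \<in> edges G. v \<in> e}))"
proof
  let ?H = "delete G (Inr ` {e \<in> edges G. v \<in> e})"
  assume "has_fpm ?H"
  then obtain g :: "'a set \<Rightarrow> real" where g: "\<forall>v\<in>verts ?H. (\<Sum>e\<in>{e \<in> edges ?H. v \<in> e}. g e) = 1"
    unfolding has_fpm_def fractional_perfect_matching_def by blast
  have v: "v \<in> verts ?H" using assms by (auto simp: delete_def)
  have empty: "{e \<in> edges ?H. v \<in> e} = {}" by (auto simp: delete_def)
  show False using bspec[OF g v] unfolding empty by simp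
qed

text \<open>The star of \<open>v\<close> provides the upper bound, which leaves only the lower bound
  on fault sets to be proved. The same holds for \<open>fmp\<close>, as a star consists of
  edges.\<close>

lemma fsmp_eqI:
  assumes v: "v \<in> verts G" "degree G v = \<delta>"
    and lower: "\<And>F. F \<subseteq> verts G <+> edges G \<Longrightarrow> \<not> has_fpm (delete G F) \<Longrightarrow> \<delta> \<le> card F"
  shows "fsmp G = \<delta>"
  unfolding fsmp_def
proof (rule Least_equality)
  let ?F = "Inr ` {e \<in> edges G. v \<in> e}"
  have "?F \<subseteq> verts G <+> edges G" by auto
  moreover have "card ?F = \<delta>" using v(2) by (simp add: card_image degree_def)
  ultimately show "\<exists>F\<subseteq>verts G <+> edges G. card F = \<delta> \<and> \<not> has_fpm (delete G F)"
    using no_fpm_delete_star[OF v(1)] by blast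
  fix m assume "\<exists>F\<subseteq>verts G <+> edges G. card F = m \<and> \<not> has_fpm (delete G F)"
  then show "\<delta> \<le> m" using lower by blast
qed

lemma fmp_eqI:
  assumes v: "v \<in> verts G" "degree G v = \<delta>"
    and lower: "\<And>F. F \<subseteq> edges G \<Longrightarrow> \<not> has_fpm (delete G (Inr ` F)) \<Longrightarrow> \<delta> \<le> card F"
  shows "fmp G = \<delta>"
  unfolding fmp_def
proof (rule Least_equality)
  let ?F = "{e \<in> edges G. v \<in> e}"
  have "?F \<subseteq> edges G" by auto
  moreover have "card ?F = \<delta>" using v(2) by (simp add: degree_def)
  ultimately show "\<exists>F\<subseteq>edges G. card F = \<delta> \<and> \<not> has_fpm (delete G (Inr ` F))"
    using no_fpm_delete_star[OF v(1)] by blast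
  fix m assume "\<exists>F\<subseteq>edges G. card F = m \<and> \<not> has_fpm (delete G (Inr ` F))"
  then show "\<delta> \<le> m" using lower by blast
qed

section \<open>Forbidden subgraphs, triangles and degrees\<close>

lemma diamond_closed:
  assumes G: "simple_graph G" and free: "free_of {K4_minus_edge} G"
    and e: "{a, b} \<in> edges G" "{a, c} \<in> edges G" "{b, c} \<in> edges G"
      "{a, d} \<in> edges G" "{b, d} \<in> edges G" and cd: "c \<noteq> d"
  shows "{c, d} \<in> edges G"
proof (rule ccontr)
  assume no: "{c, d} \<notin> edges G"
  have ne: "a \<noteq> b" "a \<noteq> c" "b \<noteq> c" "a \<noteq> d" "b \<noteq> d" and V: "{a, b, c, d} \<subseteq> verts G"
    using simple_graph_edgeD[OF G] e by blast+
  have loop: "{x} \<notin> edges G" for x using G by (auto simp: simple_graph_def)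
  \<comment> \<open>The missing edge of \<open>K4_minus_edge\<close> joins 0 and 1, so these are the
    images of \<open>c\<close> and \<open>d\<close>.\<close>
  define \<phi> :: "'a \<Rightarrow> nat" where
    "\<phi> x = (if x = c then 0 else if x = d then 1 else if x = a then 2 else 3)" for x
  have \<phi>: "\<phi> c = 0" "\<phi> d = 1" "\<phi> a = 2" "\<phi> b = 3" using ne cd by (auto simp: \<phi>_def)
  have "graph_iso (induced_subgraph G {a, b, c, d}) K4_minus_edge"
    unfolding graph_iso_def
  proof (intro exI[of _ \<phi>] conjI)
    show "bij_betw \<phi> (verts (induced_subgraph G {a, b, c, d})) (verts K4_minus_edge)"
      using ne cd by (auto simp: bij_betw_def inj_on_def induced_subgraph_def K4_minus_edge_def \<phi>)
    show "\<forall>u\<in>verts (induced_subgraph G {a, b, c, d}). \<forall>v\<in>verts (induced_subgraph G {a, b, c, d}).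
      ({u, v} \<in> edges (induced_subgraph G {a, b, c, d})) = ({\<phi> u, \<phi> v} \<in> edges K4_minus_edge)"
      using e no loop by (simp add: induced_subgraph_def K4_minus_edge_def \<phi> doubleton_eq_iff insert_commute)
  qed
  then show False using free V by (auto simp: free_of_def)
qed

text \<open>Any bijection of the vertex sets is an isomorphism, since all pairs are adjacent on both
  sides.\<close>

lemma complete_graph_iso_K4:
  assumes G: "simple_graph G" and card: "card (verts G) = 4"
    and complete: "\<And>a b. a \<in> verts G \<Longrightarrow> b \<in> verts G \<Longrightarrow> a \<noteq> b \<Longrightarrow> {a, b} \<in> edges G"
  shows "graph_iso G K4"
proof -
  have "finite (verts G)" using G by (simp add: simple_graph_def)
  moreover have cardK4: "finite (verts K4)" "card (verts K4) = 4" by (simp_all add: verts_K4)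
  ultimately obtain \<phi> where \<phi>: "bij_betw \<phi> (verts G) (verts K4)"
    using card cardK4 by (metis finite_same_card_bij)
  show ?thesis
    unfolding graph_iso_def
  proof (intro exI[of _ \<phi>] conjI ballI)
    fix u v assume uv: "u \<in> verts G" "v \<in> verts G"
    then have "\<phi> u \<in> verts K4" "\<phi> v \<in> verts K4" "\<phi> u = \<phi> v \<longleftrightarrow> u = v"
      using \<phi> by (auto simp: bij_betw_def inj_on_eq_iff)
    then show "{u, v} \<in> edges G \<longleftrightarrow> {\<phi> u, \<phi> v} \<in> edges K4"
      using complete[OF uv] edges_K4I simple_graph_edgeD(3)[OF G] simple_graph_edgeD(3)[OF simple_graph_K4]
      by blast
  qed (rule \<phi>)
qed

lemma triangle_on_edge:
  assumes "card (cycles_through G 3 {a, b}) \<ge> 1"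
  shows "\<exists>c. {a, c} \<in> edges G \<and> {b, c} \<in> edges G"
proof -
  have "cycles_through G 3 {a, b} \<noteq> {}" using assms by auto
  then obtain vs where vs: "is_cycle G vs" "length vs = 3" "{a, b} \<in> cycle_edges vs"
    by (auto simp: cycles_through_def)
  then obtain x y z where xyz: "vs = [x, y, z]"
    by (auto simp: numeral_3_eq_3 length_Suc_conv)
  have "{x, y} \<in> edges G" "{y, z} \<in> edges G" "{z, x} \<in> edges G"
    using vs(1) by (auto simp: is_cycle_def xyz cycle_edges_3)
  moreover have "{a, b} = {x, y} \<or> {a, b} = {y, z} \<or> {a, b} = {z, x}"
    using vs(3) by (simp add: xyz cycle_edges_3)
  ultimately show ?thesis by (auto simp: doubleton_eq_iff insert_commute)
qed

lemma degree_eq_card_neighbours: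
  assumes G: "simple_graph G"
  shows "degree G v = card {w. {v, w} \<in> edges G}"
proof -
  have "bij_betw (\<lambda>w. {v, w}) {w. {v, w} \<in> edges G} {e \<in> edges G. v \<in> e}"
    unfolding bij_betw_def
  proof
    show "inj_on (\<lambda>w. {v, w}) {w. {v, w} \<in> edges G}"
      by (auto simp: inj_on_def doubleton_eq_iff)
    show "(\<lambda>w. {v, w}) ` {w. {v, w} \<in> edges G} = {e \<in> edges G. v \<in> e}"
    proof (intro subset_antisym subsetI)
      fix e assume e: "e \<in> {e \<in> edges G. v \<in> e}"
      then have "card e = 2" using G by (simp add: simple_graph_def)
      then obtain w where "e = {v, w}" using e by (auto simp: card_2_iff)
      then show "e \<in> (\<lambda>w. {v, w}) ` {w. {v, w} \<in> edges G}" using e by auto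
    qed auto
  qed
  then show ?thesis unfolding degree_def by (rule bij_betw_same_card[symmetric])
qed

text \<open>The neighbours of \<open>v\<close> lie in \<open>verts G - {v}\<close>, and equal
  cardinality forces equality. Thus a \<open>\<delta>\<close>-regular graph on
  \<open>\<delta> + 1\<close> vertices is complete.\<close>

lemma degree_less_card:
  assumes G: "simple_graph G" and v: "v \<in> verts G"
  shows "degree G v < card (verts G)"
    "degree G v = card (verts G) - 1 \<Longrightarrow> w \<in> verts G \<Longrightarrow> w \<noteq> v \<Longrightarrow> {v, w} \<in> edges G"
proof -
  have fin: "finite (verts G)" using G by (simp add: simple_graph_def)
  have sub: "{w. {v, w} \<in> edges G} \<subseteq> verts G - {v}"
    using simple_graph_edgeD[OF G] by blast
  have c: "card (verts G - {v}) = card (verts G) - 1" "card (verts G) > 0"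
    using fin v by (auto simp: card_gt_0_iff)
  have "card {w. {v, w} \<in> edges G} \<le> card (verts G - {v})" using fin sub by (intro card_mono) auto
  then show "degree G v < card (verts G)" using c by (simp add: degree_eq_card_neighbours[OF G])
  assume "degree G v = card (verts G) - 1" "w \<in> verts G" "w \<noteq> v"
  then have "card {w. {v, w} \<in> edges G} = card (verts G - {v})"
    using c by (simp add: degree_eq_card_neighbours[OF G])
  then have "{w. {v, w} \<in> edges G} = verts G - {v}"
    using card_subset_eq[OF _ sub] fin by simp
  then show "{v, w} \<in> edges G" using \<open>w \<in> verts G\<close> \<open>w \<noteq> v\<close> by blast
qed

text \<open>
  Here \<open>f\<close> counts the deleted vertices, \<open>s\<close> the edges inside \<open>S\<close> (all of them deleted) and \<open>r\<close> the
  edges inside the complement of \<open>S\<close>.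
\<close>

lemma balance_contradiction_odd:
  fixes \<delta> n f s r \<sigma> \<alpha> :: nat
  assumes "\<delta> \<ge> 3" "2 * \<sigma> + f = n + 1" "s + f < \<delta>" "\<sigma> \<le> \<alpha> + s" "n - \<sigma> \<le> \<alpha> + r"
    and "\<delta> * \<sigma> + 2 * r = \<delta> * (n - \<sigma>) + 2 * s"
    and "2 * \<alpha> + 2 * \<delta> \<le> n + 3"
  shows False
proof -
  \<comment> \<open>The bounds on \<open>\<sigma>\<close>, \<open>s\<close> and
    \<open>\<alpha>\<close> add up to \<open>f \<le> 0\<close>.\<close>
  have f: "f = 0" using assms(2,3,4,7) by linarith
  then have "\<sigma> = (n - \<sigma>) + 1" using assms(2) by linarith
  then have "\<delta> * \<sigma> = \<delta> * (n - \<sigma>) + \<delta>" by (metis mult.right_neutral distrib_left)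
  then have "\<delta> + 2 * r = 2 * s" using assms(6) by linarith
  \<comment> \<open>Now \<open>s < \<delta>\<close> gives \<open>2 * r \<le> \<delta> - 2\<close>,
    whereas the bound on the complement gives \<open>r \<ge> \<delta> - 2\<close>; this is
    impossible for \<open>\<delta> \<ge> 3\<close>.\<close>
  then show False using assms(1-5,7) f by linarith
qed

section \<open>The three cases\<close>

theorem theorem3p5:
  fixes G :: "'a graph" and \<delta> :: nat
  assumes "simple_graph G"
    and "\<delta> = min_degree G"
    and "\<delta> \<ge> 3"
    and "fault_hamiltonian (\<delta> - 2) G"
  shows "(int (independence_number G) \<le> \<lceil>(real (card (verts G)) + 1) / 2\<rceil> - int \<delta>
            \<longrightarrow> fsmp G = \<delta> \<and> fmp G = \<delta>)
       \<and> (G \<in> class_G1 \<delta>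
            \<and> int (independence_number G) \<le> \<lceil>(real (card (verts G)) + 1) / 2\<rceil> - int \<delta> + 1
            \<longrightarrow> (\<not> graph_iso G K4 \<longrightarrow> fsmp G = \<delta>) \<and> fmp G = \<delta>)
       \<and> (G \<in> class_G2_4
            \<and> real (independence_number G) \<le> (real (card (verts G)) + 1) / 2 - 2
            \<longrightarrow> fsmp G = 4 \<and> fmp G = 4)"
proof -
  note G = assms(1) and \<delta>3 = assms(3)
  define n where "n = card (verts G)"
  define \<alpha> where "\<alpha> = independence_number G"
  have fin: "finite (verts G)" "finite (edges G)"
    using G simple_graph_finite_edges by (auto simp: simple_graph_def)
  have "hamiltonian (delete G {})"
    using assms(4) by (simp add: fault_hamiltonian_def)
  then have V: "verts G \<noteq> {}"
    by (auto simp: hamiltonian_def is_cycle_def delete_def)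
  then have "Min (degree G ` verts G) \<in> degree G ` verts G" using fin by (intro Min_in) auto
  then obtain v where v: "v \<in> verts G" "degree G v = \<delta>"
    using assms(2) unfolding min_degree_def by auto
  have ceil: "\<lceil>(real n + 1) / 2\<rceil> = (if odd n then (int n + 1) div 2 else int n div 2 + 1)"
  proof (cases "odd n")
    case True
    then obtain m where "n = 2 * m + 1" by (rule oddE)
    then show ?thesis by (simp add: ceiling_eq_iff)
  next
    case False
    then obtain m where "n = 2 * m" by (auto elim: evenE)
    then show ?thesis by (simp add: ceiling_eq_iff)
  qed
  have bad: "\<exists>S. S \<subseteq> verts G \<and> 2 * card S + card (Inl -` F) = n + 1 \<and>
      card {e \<in> edges G. e \<subseteq> S} + card (Inl -` F) < \<delta>"
    if "F \<subseteq> verts G <+> edges G" "\<not> has_fpm (delete G F)" "card F < \<delta>" for F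
  proof -
    have "\<delta> \<ge> 2" using \<delta>3 by simp
    from no_fpm_obtains_independent_set[OF G assms(4) this that(1,3,2)] obtain S where
      "S \<subseteq> verts G" "2 * card S + card (Inl -` F) = card (verts G) + 1"
      "card {e \<in> edges G. e \<subseteq> S} + card (Inl -` F) < \<delta>" .
    then show ?thesis unfolding n_def by blast
  qed
  have fsmpI: "fsmp G = \<delta>"
    if "\<And>S f. S \<subseteq> verts G \<Longrightarrow> 2 * card S + f = n + 1 \<Longrightarrow> card {e \<in> edges G. e \<subseteq> S} + f < \<delta> \<Longrightarrow> False"
  proof (rule fsmp_eqI[OF v])
    fix F assume F: "F \<subseteq> verts G <+> edges G" "\<not> has_fpm (delete G F)"
    show "\<delta> \<le> card F"
    proof (rule ccontr)
      assume "\<not> \<delta> \<le> card F"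
      then have "card F < \<delta>" by simp
      from bad[OF F this] show False using that by blast
    qed
  qed
  \<comment> \<open>Faults that are all edges delete no vertex, which is the case
    \<open>f = 0\<close>.\<close>
  have fmpI: "fmp G = \<delta>"
    if "\<And>S. S \<subseteq> verts G \<Longrightarrow> 2 * card S = n + 1 \<Longrightarrow> card {e \<in> edges G. e \<subseteq> S} < \<delta> \<Longrightarrow> False"
  proof (rule fmp_eqI[OF v])
    fix F assume F: "F \<subseteq> edges G" "\<not> has_fpm (delete G (Inr ` F))"
    define F' :: "('a + 'a set) set" where "F' = Inr ` F"
    have F': "Inl -` F' = {}" "card F' = card F" "F' \<subseteq> verts G <+> edges G"
      using F(1) by (auto simp: F'_def card_image)
    show "\<delta> \<le> card F"
    proof (rule ccontr)
      assume "\<not> \<delta> \<le> card F"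
      then have "card F' < \<delta>" using F'(2) by simp
      from bad[OF F'(3) F(2)[folded F'_def] this] obtain S where
        "S \<subseteq> verts G" "2 * card S = n + 1" "card {e \<in> edges G. e \<subseteq> S} < \<delta>"
        unfolding F'(1) by auto
      then show False by (rule that)
    qed
  qed
  have bothI: "fsmp G = \<delta> \<and> fmp G = \<delta>"
    if "\<And>S f. S \<subseteq> verts G \<Longrightarrow> 2 * card S + f = n + 1 \<Longrightarrow> card {e \<in> edges G. e \<subseteq> S} + f < \<delta> \<Longrightarrow> False"
  proof
    show "fsmp G = \<delta>" by (rule fsmpI) (rule that)
    show "fmp G = \<delta>" by (rule fmpI) (rule that[where f = 0], simp_all)
  qed
  have indep: "card S \<le> \<alpha> + card {e \<in> edges G. e \<subseteq> S}" if "S \<subseteq> verts G" for S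
    using card_le_independence_number[OF G that] by (simp add: \<alpha>_def)
  have compl: "card (verts G - S) = n - card S" "card S \<le> n" if "S \<subseteq> verts G" for S
    using that fin by (simp_all add: n_def card_Diff_subset finite_subset card_mono)
  have balance: "\<delta> * card S + 2 * card {e \<in> edges G. e \<subseteq> verts G - S}
      = \<delta> * (n - card S) + 2 * card {e \<in> edges G. e \<subseteq> S}"
    if "regular \<delta> G" "S \<subseteq> verts G" for S
    using regular_balance[OF G that] compl[OF that(2)] by simp
  \<comment> \<open>This is \<open>balance\<close> for the whole vertex set, whose complement is
    empty.\<close>
  have handshake: "\<delta> * n = 2 * card (edges G)" if "regular \<delta> G"
  proof -
    have "{e \<in> edges G. e \<subseteq> verts G} = edges G" using G by (auto simp: simple_graph_def)
    moreover have "{e \<in> edges G. e \<subseteq> verts G - verts G} = {}"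
      using G by (auto simp: simple_graph_def)
    ultimately show ?thesis
      using balance[OF that subset_refl] by (simp only: n_def) simp
  qed
  have uncut: "\<delta> * n \<le> 6 * (card {e \<in> edges G. e \<subseteq> S} + card {e \<in> edges G. e \<subseteq> verts G - S})"
    if G': "regular \<delta> G" "free_of {K4_minus_edge} G"
      "\<And>e. e \<in> edges G \<Longrightarrow> card (cycles_through G 3 e) \<ge> 1" and S: "S \<subseteq> verts G" for S
  proof -
    have "card (edges G) \<le> 3 * (card {e \<in> edges G. e \<subseteq> S} + card {e \<in> edges G. e \<subseteq> verts G - S})"
    proof (rule edges_le_thrice_uncut[OF G S])
      show "{c, d} \<in> edges G" if "{a, b} \<in> edges G" "{a, c} \<in> edges G" "{b, c} \<in> edges G"
        "{a, d} \<in> edges G" "{b, d} \<in> edges G" "c \<noteq> d" for a b c d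
        by (rule diamond_closed[OF G G'(2) that])
      show "\<exists>c. {a, c} \<in> edges G \<and> {b, c} \<in> edges G" if "{a, b} \<in> edges G" for a b
        by (rule triangle_on_edge[OF G'(3)[OF that]])
    qed
    then show ?thesis using handshake[OF G'(1)] by linarith
  qed
  have n_gt: "\<delta> < n" using degree_less_card(1)[OF G v(1)] v(2) by (simp add: n_def)
  have complete: "{a, b} \<in> edges G"
    if "regular \<delta> G" "n = \<delta> + 1" "a \<in> verts G" "b \<in> verts G" "a \<noteq> b" for a b
  proof (rule degree_less_card(2)[OF G that(3) _ that(4)])
    show "degree G a = card (verts G) - 1" using that(1-3) by (simp add: n_def regular_def)
  qed (use that(5) in simp)

  have part1: "fsmp G = \<delta> \<and> fmp G = \<delta>" if "int \<alpha> \<le> \<lceil>(real n + 1) / 2\<rceil> - int \<delta>"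
  proof (rule bothI)
    fix S f assume S: "S \<subseteq> verts G" "2 * card S + f = n + 1" "card {e \<in> edges G. e \<subseteq> S} + f < \<delta>"
    have "2 * \<alpha> + 2 * \<delta> \<le> n + 2"
      using that unfolding ceil by (cases "odd n") (auto elim!: oddE evenE)
    \<comment> \<open>The inequalities would force \<open>f \<le> -1\<close>.\<close>
    then show False using indep[OF S(1)] S(2,3) by linarith
  qed

  have part2: "(\<not> graph_iso G K4 \<longrightarrow> fsmp G = \<delta>) \<and> fmp G = \<delta>"
    if G1: "G \<in> class_G1 \<delta>" and \<alpha>: "int \<alpha> \<le> \<lceil>(real n + 1) / 2\<rceil> - int \<delta> + 1"
  proof (cases "odd n")
    case True
    have reg: "regular \<delta> G" using G1 by (simp add: class_G1_def)
    have \<alpha>': "2 * \<alpha> + 2 * \<delta> \<le> n + 3" using \<alpha> True unfolding ceil by (auto elim: oddE)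
    have "fsmp G = \<delta> \<and> fmp G = \<delta>"
    proof (rule bothI)
      fix S f assume S: "S \<subseteq> verts G" "2 * card S + f = n + 1" "card {e \<in> edges G. e \<subseteq> S} + f < \<delta>"
      have "n - card S \<le> \<alpha> + card {e \<in> edges G. e \<subseteq> verts G - S}"
        using indep[OF Diff_subset] compl(1)[OF S(1)] by metis
      then show False
        by (rule balance_contradiction_odd[OF \<delta>3 S(2,3) indep[OF S(1)] _ balance[OF reg S(1)] \<alpha>'])
    qed
    then show ?thesis by simp
  next
    case False
    then have G1': "regular \<delta> G" "free_of {K4_minus_edge} G"
      "\<And>e. e \<in> edges G \<Longrightarrow> card (cycles_through G 3 e) \<ge> 1"
      using G1 by (auto simp: class_G1_def n_def)
    have \<alpha>': "2 * \<alpha> + 2 * \<delta> \<le> n + 4" using \<alpha> False unfolding ceil by (auto elim: evenE)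
    \<comment> \<open>For even \<open>n\<close> the equation \<open>2 * card S = n + 1\<close> has
      no solution.\<close>
    have "fmp G = \<delta>" by (rule fmpI) (use False in presburger)
    moreover have "fsmp G = \<delta>" if no_K4: "\<not> graph_iso G K4"
    proof (rule fsmpI)
      fix S f assume S: "S \<subseteq> verts G" "2 * card S + f = n + 1" "card {e \<in> edges G. e \<subseteq> S} + f < \<delta>"
      define s where "s = card {e \<in> edges G. e \<subseteq> S}"
      define r where "r = card {e \<in> edges G. e \<subseteq> verts G - S}"
      \<comment> \<open>The weaker bound on \<open>\<alpha>\<close> leaves room for one deleted
        vertex, and parity requires exactly one. Then \<open>S\<close> is half of the vertices and
        \<open>balance\<close> gives \<open>r = s\<close>.\<close>
      have "f \<le> 1" using indep[OF S(1)] S(2,3) \<alpha>' by linarith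
      moreover have "odd f" using S(2) False by presburger
      ultimately have f: "f = 1" by (cases f) auto
      then have half: "n - card S = card S" using S(2) by linarith
      then have rs: "r = s" using balance[OF G1'(1) S(1)] by (simp add: r_def s_def)
      have "\<delta> * n \<le> 6 * (s + r)"
        using uncut[OF G1' S(1)] by (simp only: r_def s_def)
      then have "\<delta> * n \<le> 12 * s" using rs by simp
      moreover have "12 * s + 24 \<le> 12 * \<delta>" using S(3) f by (simp add: s_def)
      ultimately have dn: "\<delta> * n + 24 \<le> 12 * \<delta>" by (meson add_le_mono1 le_trans)
      show False
      proof (cases "n = \<delta> + 1")
        case True
        have "\<not> e \<subseteq> {v}" if "e \<in> edges G" for e
          using G that card_mono[of "{v}" e] by (auto simp: simple_graph_def)
        then have "independent_set G {v}" using v(1) by (simp add: independent_set_def)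
        then have "\<alpha> \<ge> 1" using independent_set_card_le[OF G] by (fastforce simp: \<alpha>_def)
        \<comment> \<open>With \<open>n = \<delta> + 1\<close> the bound reads
          \<open>2 * \<alpha> + \<delta> \<le> 5\<close>, so \<open>\<delta> = 3\<close> and
          \<open>G\<close> is the exceptional complete graph.\<close>
        then have "n = 4" using \<alpha>' True \<delta>3 by linarith
        then have "graph_iso G K4"
          by (intro complete_graph_iso_K4[OF G] complete[OF G1'(1) True]) (simp add: n_def)
        then show False using no_K4 by simp
      next
        case False
        \<comment> \<open>A vertex not adjacent to \<open>v\<close> raises \<open>\<alpha>\<close>
          to at least 2, which forces \<open>2 * \<delta> \<le> n\<close>.\<close>
        obtain w where w: "w \<in> verts G" "w \<noteq> v" "{v, w} \<notin> edges G"
        proof (rule ccontr)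
          assume "\<not> thesis"
          then have "{v, w} \<in> edges G" if "w \<in> verts G - {v}" for w
            using that \<open>\<And>w. w \<in> verts G \<Longrightarrow> w \<noteq> v \<Longrightarrow> {v, w} \<notin> edges G \<Longrightarrow> thesis\<close> by blast
          moreover have "w \<in> verts G - {v}" if "{v, w} \<in> edges G" for w
            using simple_graph_edgeD[OF G that] by simp
          ultimately have "{w. {v, w} \<in> edges G} = verts G - {v}" by blast
          then have "\<delta> = n - 1"
            using v fin by (simp add: degree_eq_card_neighbours[OF G] n_def)
          then show False using False n_gt by linarith
        qed
        have "e = {v, w}" if e: "e \<in> edges G" "e \<subseteq> {v, w}" for e
        proof (rule card_subset_eq)
          show "card e = card {v, w}" using G e(1) w(2) by (simp add: simple_graph_def)
        qed (use e(2) in auto)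
        then have "independent_set G {v, w}"
          using v(1) w(1,3) unfolding independent_set_def by blast
        then have "\<alpha> \<ge> 2" using independent_set_card_le[OF G, of "{v, w}"] w(2) by (simp add: \<alpha>_def)
        then have "2 * \<delta> \<le> n" using \<alpha>' by linarith
        then have "2 * (\<delta> * \<delta>) \<le> \<delta> * n" by (metis mult.left_commute mult_le_mono2)
        then have "2 * (\<delta> * \<delta>) + 24 \<le> 12 * \<delta>" using dn by linarith
        \<comment> \<open>The contradiction is that
          \<open>\<delta>^2 - 6 * \<delta> + 12 = (\<delta> - 3)^2 + 3\<close> is positive; writing
          \<open>\<delta> = 3 + k\<close> shows it within the naturals.\<close>
        moreover obtain k where "\<delta> = 3 + k" using \<delta>3 le_Suc_ex by blast
        ultimately show False by (simp add: distrib_left distrib_right)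
      qed
    qed
    ultimately show ?thesis by simp
  qed

  have part3: "fsmp G = 4 \<and> fmp G = 4" if G2: "G \<in> class_G2_4"
  proof -
    have G2': "regular 4 G" "free_of {K4, K4_minus_edge, K23} G" "odd n"
      "\<And>e. e \<in> edges G \<Longrightarrow> card (cycles_through G 3 e) \<ge> 1"
      using G2 by (simp_all add: class_G2_4_def n_def)
    have free: "free_of {K4_minus_edge} G" "free_of {K4} G"
      using G2'(2) unfolding free_of_def by blast+
    have \<delta>: "\<delta> = 4" using G2'(1) v by (simp add: regular_def)
    then have reg: "regular \<delta> G" using G2'(1) by simp
    have "fsmp G = \<delta> \<and> fmp G = \<delta>"
    proof (rule bothI)
      fix S f assume S: "S \<subseteq> verts G" "2 * card S + f = n + 1" "card {e \<in> edges G. e \<subseteq> S} + f < \<delta>"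
      define s where "s = card {e \<in> edges G. e \<subseteq> S}"
      define r where "r = card {e \<in> edges G. e \<subseteq> verts G - S}"
      have E: "2 * n \<le> 3 * (s + r)"
        using uncut[OF reg free(1) G2'(4) S(1)] unfolding r_def[symmetric] s_def[symmetric] \<delta> by linarith
      have "4 * card S + 2 * r = 4 * (n - card S) + 2 * s"
        using balance[OF reg S(1)] \<delta> by (simp add: r_def s_def)
      moreover have "even f" using S(2) \<open>odd n\<close> by presburger
      then have "f = 0 \<or> f = 2" using S(3) \<delta> by presburger
      \<comment> \<open>By balance \<open>s = r + 2\<close> with \<open>s \<le> 3\<close> if
        \<open>f = 0\<close>, and \<open>r = s + 2\<close> with \<open>s \<le> 1\<close> if
        \<open>f = 2\<close>.\<close>
      ultimately have "s + r \<le> 4"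
        using S(2,3) \<delta> compl(2)[OF S(1)] unfolding s_def[symmetric] by linarith
      then have "3 * (s + r) \<le> 12" by simp
      with E have "n \<le> 6" by linarith
      \<comment> \<open>The order is odd, exceeds 4 and is at most 6, so \<open>G\<close> is
        complete on five vertices and any four of them induce a forbidden \<open>K4\<close>.\<close>
      then have "n = \<delta> + 1" using n_gt \<delta> \<open>odd n\<close> by presburger
      note n = this and complete = complete[OF reg this]
      have "4 \<le> card (verts G)" using n \<delta> by (simp add: n_def)
      then obtain U where U: "U \<subseteq> verts G" "card U = 4"
        by (rule obtain_subset_with_card_n)
      have "graph_iso (induced_subgraph G U) K4"
      proof (rule complete_graph_iso_K4)
        show "simple_graph (induced_subgraph G U)"
          using G finite_subset[OF U(1) fin(1)] by (simp add: simple_graph_def induced_subgraph_def)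
        show "card (verts (induced_subgraph G U)) = 4" using U(2) by (simp add: induced_subgraph_def)
        fix a b assume "a \<in> verts (induced_subgraph G U)" "b \<in> verts (induced_subgraph G U)" "a \<noteq> b"
        then have "a \<in> U" "b \<in> U" "a \<noteq> b" by (simp_all add: induced_subgraph_def)
        then show "{a, b} \<in> edges (induced_subgraph G U)"
          using complete[of a b] U(1) by (auto simp: induced_subgraph_def)
      qed
      then show False using free(2) U(1) unfolding free_of_def by blast
    qed
    then show ?thesis using \<delta> by simp
  qed

  show ?thesis
  proof (intro conjI[OF impI conjI[OF impI impI]])
    assume "int (independence_number G) \<le> \<lceil>(real (card (verts G)) + 1) / 2\<rceil> - int \<delta>"
    then show "fsmp G = \<delta> \<and> fmp G = \<delta>" by (rule part1[unfolded n_def \<alpha>_def])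
  next
    assume "G \<in> class_G1 \<delta> \<and>
      int (independence_number G) \<le> \<lceil>(real (card (verts G)) + 1) / 2\<rceil> - int \<delta> + 1"
    then show "(\<not> graph_iso G K4 \<longrightarrow> fsmp G = \<delta>) \<and> fmp G = \<delta>"
      by (elim conjE) (rule part2[unfolded n_def \<alpha>_def])
  qed (elim conjE, rule part3)
qed

end
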